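(* Let $M^n=\{x\in\mathbb{R}^n_+:\sum_{i=1}^nx_i=1\}$, let $C:M^n\rightrightarrows\mathbb{R}^n$ be a set-valued map with nonempty compact convex values, and let $D$ be a self segment-dense subset of $M^n$. For $x\in M^n$ and $y\in\mathbb{R}^n$ put $\sigma(C(x),y)=\sup_{z\in C(x)}\langle z,y\rangle$. Suppose that (i) for all $y\in D$, the function $x\mapsto\sigma(C(x),y)$ is upper semicontinuous on $M^n$; (ii) for all $x\in D$, $\sigma(C(x),x)\ge 0$. Then there exists $x_0\in M^n$ such that $C(x_0)\cap\mathbb{R}^n_+\neq\emptyset$.
   Context: Self segment-dense: for $U\subseteq V\subseteq\mathbb{R}^n$ with $V$ convex, $U$ is self segment-dense in $V$ if $U$ is dense in $V$ (i.e. $V\subseteq\operatorname{cl}(U)$) and for all $x,y\in U$ the set $[x,y]\cap U$ is dense in the closed segment $[x,y]=\{x+t(y-x):t\in[0,1]\}$. Here $\mathbb{R}^n_+$ is the set of vectors with nonnegative coordinates and $\langle\cdot,\cdot\rangle$ is the Euclidean inner product. *)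

theory Defs
  imports "HOL-Analysis.Analysis"
begin

definition nonneg_orthant :: "(real ^ 'n) set" where
  "nonneg_orthant = {x. \<forall>i. 0 \<le> x $ i}"

text \<open>The index type is nonempty, so the dimension is at least 1.\<close>

definition unit_simplex :: "(real ^ 'n) set" where
  "unit_simplex = {x \<in> nonneg_orthant. (\<Sum>i\<in>UNIV. x $ i) = 1}"

definition self_segment_dense :: "'a::real_normed_vector set \<Rightarrow> 'a set \<Rightarrow> bool" where
  "self_segment_dense U V \<longleftrightarrow>
     U \<subseteq> V \<and> convex V \<and> V \<subseteq> closure U \<and>
     (\<forall>x\<in>U. \<forall>y\<in>U. closed_segment x y \<subseteq> closure (closed_segment x y \<inter> U))"

text \<open>The supremum is taken in the reals, so it is meaningful only for nonempty bounded sets.\<close>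

definition support_function :: "'a::real_inner set \<Rightarrow> 'a \<Rightarrow> real" where
  "support_function A y = (SUP z\<in>A. z \<bullet> y)"

definition upper_semicontinuous_on :: "'a::topological_space set \<Rightarrow> ('a \<Rightarrow> real) \<Rightarrow> bool" where
  "upper_semicontinuous_on S f \<longleftrightarrow>
     (\<forall>x\<in>S. \<forall>a. f x < a \<longrightarrow> (\<forall>\<^sub>F x' in at x within S. f x' < a))"

lemma convex_unit_simplex: "convex (unit_simplex :: (real ^ 'n) set)"
proof (rule convexI)
  fix x y :: "real ^ 'n" and u v :: real
  assume x: "x \<in> unit_simplex" and y: "y \<in> unit_simplex"
    and uv: "0 \<le> u" "0 \<le> v" "u + v = 1"
  have "(\<Sum>i\<in>UNIV. (u *\<^sub>R x + v *\<^sub>R y) $ i)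
      = u * (\<Sum>i\<in>UNIV. x $ i) + v * (\<Sum>i\<in>UNIV. y $ i)"
    by (simp add: sum.distrib sum_distrib_left)
  also have "\<dots> = 1"
    using x y uv by (simp add: unit_simplex_def)
  finally show "u *\<^sub>R x + v *\<^sub>R y \<in> unit_simplex"
    using x y uv by (simp add: unit_simplex_def nonneg_orthant_def)
qed

end

theory Submission
  imports Defs
begin

text \<open>If every \<^term>\<open>C x\<close> misses the orthant, separation together with the density of \<^term>\<open>D\<close>
  produces, for each point \<^term>\<open>x\<close> of the simplex, some \<^term>\<open>y \<in> D\<close> on which the support function
  of \<^term>\<open>C x\<close> is negative, and by semicontinuity it stays negative for points near \<^term>\<open>x\<close>.
  A partition of unity and Brouwer's theorem yield a point in the hull of those \<^term>\<open>y\<close> that are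
  good for it. This point need not lie in \<^term>\<open>D\<close>, but \<^term>\<open>D\<close> is dense in the convex hull of any of its
  finite subsets, and being good is an open condition, so the point can be moved into \<^term>\<open>D\<close>;
  there the sublinearity of the support function contradicts the sign hypothesis on
  \<^term>\<open>D\<close>.\<close>

text \<open>When \<open>q\<close> lies in \<open>D\<close> itself, self segment-density applies
  directly to the segment from \<open>a\<close> to \<open>q\<close>. A limit point \<open>q\<close>
  is reached by fixing the parameter \<open>t\<close> and using continuity of the point at parameter
  \<open>t\<close> in the far endpoint.\<close>

lemma closed_segment_subset_closure_convex_hull:
  assumes D: "self_segment_dense D V" and a: "a \<in> D" and q: "q \<in> closure (D \<inter> convex hull T)"
  shows "closed_segment a q \<subseteq> closure (D \<inter> convex hull (insert a T))"
proof
  let ?K = "closure (D \<inter> convex hull (insert a T))"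
  fix p assume "p \<in> closed_segment a q"
  then obtain t where t: "p = (1 - t) *\<^sub>R a + t *\<^sub>R q" "0 \<le> t" "t \<le> 1"
    by (auto simp: in_segment)
  let ?f = "\<lambda>q. (1 - t) *\<^sub>R a + t *\<^sub>R q"
  have "?f ` closure (D \<inter> convex hull T) \<subseteq> ?K"
  proof (rule image_closure_subset)
    show "continuous_on (closure (D \<inter> convex hull T)) ?f"
      by (intro continuous_intros)
    show "?f ` (D \<inter> convex hull T) \<subseteq> ?K"
    proof clarify
      fix r assume r: "r \<in> D" "r \<in> convex hull T"
      have "?f r \<in> closed_segment a r"
        using t by (auto simp: in_segment)
      also have "closed_segment a r \<subseteq> closure (closed_segment a r \<inter> D)"
        using D a r by (auto simp: self_segment_dense_def)
      also have "\<dots> \<subseteq> ?K"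
      proof (intro closure_mono Int_greatest)
        have "r \<in> convex hull (insert a T)"
          using r hull_mono[of T "insert a T" convex] by auto
        then have "closed_segment a r \<subseteq> convex hull (insert a T)"
          by (intro closed_segment_subset) (auto simp: hull_inc)
        then show "closed_segment a r \<inter> D \<subseteq> convex hull (insert a T)" by auto
      qed auto
      finally show "?f r \<in> ?K" .
    qed
  qed auto
  then show "p \<in> ?K"
    using q t by auto
qed

text \<open>Induction on \<open>T\<close>: the hull of \<open>insert a T\<close> is swept out by
  segments from \<open>a\<close> to points of the hull of \<open>T\<close>, and by induction these
  far endpoints are limits of points of \<open>D\<close> in that hull.\<close>

lemma self_segment_dense_convex_hull:
  assumes D: "self_segment_dense D V" and "finite T" "T \<subseteq> D"
  shows "convex hull T \<subseteq> closure (D \<inter> convex hull T)"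
  using assms(2,3)
proof (induction T rule: finite_induct)
  case empty
  then show ?case by simp
next
  case (insert a T)
  show ?case
  proof (cases "T = {}")
    case True
    then show ?thesis using insert.prems by auto
  next
    case False
    have "convex hull (insert a T) = (\<Union>q\<in>convex hull T. closed_segment a q)"
      using False by (simp add: convex_hull_insert_segments)
    also have "\<dots> \<subseteq> closure (D \<inter> convex hull (insert a T))"
      using closed_segment_subset_closure_convex_hull[OF D, of a] insert by blast
    finally show ?thesis .
  qed
qed

text \<open>A partition of unity subordinate to a finite subcover, used as weights on the indices
  \<open>y\<close>, defines a continuous self-map of \<open>S\<close>. A Brouwer fixed point
  \<open>x\<close> is then a convex combination of exactly those \<open>y\<close> with positive
  weight at \<open>x\<close>, that is, with \<open>x\<close> in \<open>U y\<close>.\<close>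

lemma open_cover_convex_hull_point:
  fixes S :: "'a::euclidean_space set"
  assumes S: "compact S" "convex S" "S \<noteq> {}" and "D \<subseteq> S"
    and opn: "\<And>y. y \<in> D \<Longrightarrow> open (U y)" and cover: "S \<subseteq> (\<Union>y\<in>D. U y)"
  obtains I x where "finite I" "I \<subseteq> D" "x \<in> convex hull I" "\<And>y. y \<in> I \<Longrightarrow> x \<in> U y"
proof (cases "\<exists>y\<in>D. y \<in> U y")
  case True
  then show ?thesis using that[of "{y}" y for y] by auto
next
  \<comment> \<open>Now each \<open>U y\<close> omits \<open>y\<close>, so its complement is
    nonempty. This matters because \<open>infdist\<close> to the empty set is 0 by convention, and
    the weight below would then vanish on all of \<open>U y\<close>.\<close>
  case False
  obtain T where T: "T \<subseteq> D" "finite T" "S \<subseteq> (\<Union>y\<in>T. U y)"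
    using compactE_image[OF S(1) opn cover] by blast
  define w where "w y x = infdist x (- U y)" for y x
  have w0: "0 \<le> w y x" for y x
    by (simp add: w_def infdist_nonneg)
  have w_pos: "0 < w y x \<longleftrightarrow> x \<in> U y" if "y \<in> T" for y x
  proof -
    have "closed (- U y)" "- U y \<noteq> {}"
      using that T(1) opn False by (auto simp: closed_Compl)
    then show ?thesis
      using in_closed_iff_infdist_zero[of "- U y" x] w0[of y x] by (auto simp: w_def)
  qed
  define g where "g x = (\<Sum>y\<in>T. w y x)" for x
  have g_pos: "0 < g x" if "x \<in> S" for x
  proof -
    obtain y where "y \<in> T" "x \<in> U y" using \<open>x \<in> S\<close> T(3) by blast
    then show ?thesis
      unfolding g_def using T(2) w_pos w0 by (intro sum_pos2[of T y]) auto
  qed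
  define f where "f x = (\<Sum>y\<in>T. (w y x / g x) *\<^sub>R y)" for x
  have weights: "(\<Sum>y\<in>T. w y x / g x) = 1" if "x \<in> S" for x
    using g_pos[OF that] by (simp add: g_def flip: sum_divide_distrib)
  have "continuous_on S f"
    unfolding f_def using g_pos
    by (intro continuous_intros) (auto simp: g_def w_def less_imp_neq[symmetric] intro!: continuous_intros)
  moreover have "f \<in> S \<rightarrow> S"
  proof
    fix x assume "x \<in> S"
    then show "f x \<in> S"
      unfolding f_def using T \<open>D \<subseteq> S\<close> S weights g_pos[of x] w0
      by (intro convex_sum) auto
  qed
  ultimately obtain x where x: "x \<in> S" "f x = x"
    using brouwer[OF S] by blast
  let ?I = "{y\<in>T. x \<in> U y}"
  have out: "w y x = 0" if "y \<in> T - ?I" for y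
    using that w_pos[of y x] w0[of y x] by auto
  have "(\<Sum>y\<in>?I. w y x / g x) = 1"
    using weights[OF x(1)] sum.mono_neutral_left[of T ?I "\<lambda>y. w y x / g x"] T(2) out by auto
  then have "(\<Sum>y\<in>?I. (w y x / g x) *\<^sub>R y) \<in> convex hull ?I"
    using T(2) w0 g_pos[OF x(1)] by (intro convex_sum) (auto simp: hull_inc)
  also have "(\<Sum>y\<in>?I. (w y x / g x) *\<^sub>R y) = f x"
    unfolding f_def using T(2) out by (intro sum.mono_neutral_left) auto
  finally have "x \<in> convex hull ?I"
    by (simp only: x(2))
  then show ?thesis
    by (rule that[rotated 2]) (use T(1,2) in auto)
qed

text \<open>Compactness makes the supremum a maximum, so the strict inequality survives in both
  directions.\<close>

lemma support_function_less_iff: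
  assumes "compact A" "A \<noteq> {}"
  shows "support_function A y < a \<longleftrightarrow> (\<forall>z\<in>A. z \<bullet> y < a)"
proof -
  have "continuous_on A (\<lambda>z. z \<bullet> y)"
    by (intro continuous_intros)
  then have cpt: "compact ((\<lambda>z. z \<bullet> y) ` A)"
    using assms by (intro compact_continuous_image)
  obtain z0 where z0: "z0 \<in> A" "\<forall>z\<in>A. z \<bullet> y \<le> z0 \<bullet> y"
    using continuous_attains_sup[OF assms \<open>continuous_on A _\<close>] by blast
  then have "support_function A y = z0 \<bullet> y"
    unfolding support_function_def by (intro cSup_eq_maximum) auto
  then show ?thesis using z0 by (auto intro: le_less_trans)
qed

lemma upper_semicontinuous_on_openin:
  assumes "upper_semicontinuous_on S f"
  shows "openin (top_of_set S) {x\<in>S. f x < a}"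
  unfolding openin_subopen[of _ "{x\<in>S. f x < a}"]
proof
  fix x assume x: "x \<in> {x\<in>S. f x < a}"
  then have "\<forall>\<^sub>F x' in at x within S. f x' < a"
    using assms by (auto simp: upper_semicontinuous_on_def)
  then obtain V where "open V" "x \<in> V" "\<forall>x'\<in>V. x' \<noteq> x \<longrightarrow> x' \<in> S \<longrightarrow> f x' < a"
    by (auto simp: eventually_at_topological)
  then show "\<exists>T. openin (top_of_set S) T \<and> x \<in> T \<and> T \<subseteq> {x\<in>S. f x < a}"
    using x by (intro exI[of _ "S \<inter> V"]) (auto simp: openin_open_Int)
qed

lemma convex_nonneg_orthant: "convex (nonneg_orthant :: (real ^ 'n) set)"
  by (auto simp: convex_def nonneg_orthant_def)

lemma closed_nonneg_orthant: "closed (nonneg_orthant :: (real ^ 'n) set)"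
  unfolding nonneg_orthant_def
  by (intro closed_Collect_all closed_Collect_le continuous_intros)

lemma compact_unit_simplex: "compact (unit_simplex :: (real ^ 'n) set)"
proof -
  have "closed {x :: real ^ 'n. (\<Sum>i\<in>UNIV. x $ i) = 1}"
    by (intro closed_Collect_eq continuous_intros)
  then have "closed (unit_simplex :: (real ^ 'n) set)"
    using closed_Int[OF closed_nonneg_orthant] by (simp add: unit_simplex_def Collect_conj_eq)
  moreover have "norm x \<le> 1" if "x \<in> unit_simplex" for x :: "real ^ 'n"
    using that norm_le_l1_cart[of x] by (auto simp: unit_simplex_def nonneg_orthant_def)
  then have "bounded (unit_simplex :: (real ^ 'n) set)"
    by (auto simp: bounded_iff)
  ultimately show ?thesis by (simp add: compact_eq_bounded_closed)
qed

lemma unit_simplex_nonempty: "(unit_simplex :: (real ^ 'n) set) \<noteq> {}"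
proof -
  have "axis undefined 1 \<in> (unit_simplex :: (real ^ 'n) set)"
    by (auto simp: unit_simplex_def nonneg_orthant_def axis_def)
  then show ?thesis by blast
qed

text \<open>A functional separating \<open>A\<close> strictly from the orthant is bounded below on
  that cone, which forces nonnegative coefficients. It is nonzero, so dividing by the coefficient
  sum puts it in the simplex without changing signs.\<close>

lemma separation_from_nonneg_orthant:
  fixes A :: "(real ^ 'n) set"
  assumes A: "compact A" "convex A" "A \<noteq> {}" and disj: "A \<inter> nonneg_orthant = {}"
  obtains y where "y \<in> unit_simplex" "support_function A y < 0"
proof -
  obtain a b where ab: "\<forall>z\<in>A. a \<bullet> z < b" "\<forall>z\<in>nonneg_orthant. b < a \<bullet> z"
    using separating_hyperplane_compact_closed
      [OF A(2,1,3) convex_nonneg_orthant closed_nonneg_orthant disj] by blast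
  have "b < a \<bullet> 0"
    using ab(2) by (rule bspec) (simp add: nonneg_orthant_def)
  then have b: "b < 0" by simp
  have a_nonneg: "0 \<le> a $ i" for i
  proof (rule ccontr)
    assume neg: "\<not> 0 \<le> a $ i"
    \<comment> \<open>Both \<open>b\<close> and \<open>a $ i\<close> are negative, so this vector
      lies in the orthant, yet its inner product with \<open>a\<close> is exactly
      \<open>b\<close>.\<close>
    have "b < a \<bullet> axis i (b / a $ i)"
      using ab(2) by (rule bspec) (use neg b in \<open>auto simp: nonneg_orthant_def axis_def divide_nonpos_neg\<close>)
    then show False using neg by (simp add: inner_axis)
  qed
  define s where "s = (\<Sum>i\<in>UNIV. a $ i)"
  have "a \<noteq> 0" using ab(1) A(3) b by force
  then obtain i where "a $ i \<noteq> 0" by (auto simp: vec_eq_iff)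
  then have s: "0 < s"
    unfolding s_def using a_nonneg by (intro sum_pos2[of _ i]) (auto simp: less_le)
  show ?thesis
  proof
    show "a /\<^sub>R s \<in> unit_simplex"
      using a_nonneg s
      by (simp add: unit_simplex_def nonneg_orthant_def s_def flip: sum_distrib_left)
    show "support_function A (a /\<^sub>R s) < 0"
      unfolding support_function_less_iff[OF A(1,3)]
      using ab(1) b s by (force simp: inner_commute mult_less_0_iff)
  qed
qed

text \<open>The complement is the projection, along the compact set \<open>A\<close>, of a closed
  set of pairs, hence closed.\<close>

lemma open_support_function_less:
  fixes A :: "'a::euclidean_space set"
  assumes A: "compact A" "A \<noteq> {}"
  shows "open {y. support_function A y < a}"
proof -
  have "closed {y. \<exists>z. z \<in> A \<and> (z, y) \<in> {(z, y). a \<le> z \<bullet> y}}"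
    using A(1)
    by (rule closed_compact_projection)
      (auto simp: case_prod_unfold intro!: closed_Collect_le continuous_intros)
  also have "{y. \<exists>z. z \<in> A \<and> (z, y) \<in> {(z, y). a \<le> z \<bullet> y}} = - {y. support_function A y < a}"
    by (auto simp: support_function_less_iff[OF A] not_less)
  finally show ?thesis by (simp add: open_closed)
qed

theorem theorem5p1:
  fixes C :: "real ^ 'n \<Rightarrow> (real ^ 'n) set"
    and D :: "(real ^ 'n) set"
  assumes C_values: "\<And>x. x \<in> unit_simplex \<Longrightarrow> C x \<noteq> {} \<and> compact (C x) \<and> convex (C x)"
    and D_dense: "self_segment_dense D unit_simplex"
    and usc: "\<And>y. y \<in> D \<Longrightarrow> upper_semicontinuous_on unit_simplex (\<lambda>x. support_function (C x) y)"
    and nonneg: "\<And>x. x \<in> D \<Longrightarrow> support_function (C x) x \<ge> 0"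
  shows "\<exists>x0\<in>unit_simplex. C x0 \<inter> nonneg_orthant \<noteq> {}"
proof (rule ccontr)
  assume contra: "\<not> ?thesis"
  have D: "D \<subseteq> unit_simplex" "unit_simplex \<subseteq> closure D"
    using D_dense by (auto simp: self_segment_dense_def)
  have "\<exists>U. open U \<and> {x\<in>unit_simplex. support_function (C x) y < 0} = unit_simplex \<inter> U"
    if "y \<in> D" for y
    using upper_semicontinuous_on_openin[OF usc[OF that]] by (simp add: openin_open)
  then obtain U where U: "\<And>y. y \<in> D \<Longrightarrow> open (U y)"
    "\<And>y. y \<in> D \<Longrightarrow> {x\<in>unit_simplex. support_function (C x) y < 0} = unit_simplex \<inter> U y"
    by metis
  have cover: "unit_simplex \<subseteq> (\<Union>y\<in>D. U y)"
  proof
    fix x :: "real ^ 'n" assume x: "x \<in> unit_simplex"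
    then obtain y where y: "y \<in> unit_simplex" "support_function (C x) y < 0"
      using separation_from_nonneg_orthant[of "C x"] C_values contra by blast
    let ?N = "{y. support_function (C x) y < 0}"
    \<comment> \<open>The separating vector \<open>y\<close> need not belong to \<open>D\<close>;
      openness in the second argument of the support function allows replacing it by a nearby point
      of \<open>D\<close>.\<close>
    have "open ?N"
      using open_support_function_less C_values[OF x] by blast
    moreover have "y \<in> ?N \<inter> closure D"
      using y D(2) by auto
    ultimately obtain y' where "y' \<in> D" "support_function (C x) y' < 0"
      using open_Int_closure_eq_empty[of ?N D] by blast
    then show "x \<in> (\<Union>y\<in>D. U y)"
      using U(2) x by blast
  qed
  obtain I p where I: "finite I" "I \<subseteq> D" and p: "p \<in> convex hull I" "\<And>y. y \<in> I \<Longrightarrow> p \<in> U y"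
    by (rule open_cover_convex_hull_point
      [OF compact_unit_simplex convex_unit_simplex unit_simplex_nonempty D(1) U(1) cover]) blast+
  \<comment> \<open>Finiteness of \<open>I\<close> keeps the intersection open, so \<open>p\<close>
    can be moved to a point of \<open>D\<close> that still lies in the hull of \<open>I\<close> and
    in every \<open>U y\<close>.\<close>
  have "open (\<Inter>y\<in>I. U y)"
    using I U(1) by auto
  moreover have "p \<in> (\<Inter>y\<in>I. U y) \<inter> closure (D \<inter> convex hull I)"
    using p self_segment_dense_convex_hull[OF D_dense I] by auto
  ultimately obtain x where x: "x \<in> D" "x \<in> convex hull I" "\<And>y. y \<in> I \<Longrightarrow> x \<in> U y"
    using open_Int_closure_eq_empty[of "\<Inter>y\<in>I. U y" "D \<inter> convex hull I"] by blast
  have neg: "support_function (C x) y < 0" if "y \<in> I" for y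
    using that x D(1) I(2) U(2)[of y] by blast
  have Cx: "compact (C x)" "C x \<noteq> {}"
    using C_values x(1) D(1) by auto
  \<comment> \<open>For fixed \<open>z\<close>, the open half-space of vectors with negative inner
    product with \<open>z\<close> is convex and contains \<open>I\<close>, hence also the hull point
    \<open>x\<close>.\<close>
  have "z \<bullet> x < 0" if "z \<in> C x" for z
  proof -
    have "I \<subseteq> {y. z \<bullet> y < 0}"
      using neg that by (auto simp: support_function_less_iff[OF Cx])
    then have "convex hull I \<subseteq> {y. z \<bullet> y < 0}"
      by (intro hull_minimal convex_halfspace_lt)
    then show ?thesis using x(2) by auto
  qed
  then have "support_function (C x) x < 0"
    by (simp add: support_function_less_iff[OF Cx])
  then show False
    using nonneg[OF x(1)] by simp
qed

end
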